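(* Let $(\mathcal{S},\succeq)$ be a lattice of pairwise disjoint finite state-spaces with projections $r^{S'}_S$, let $(\mathcal{E},\leqslant)$ be its lattice of events, let $(\mathcal{E}',\sqsubseteq)$ be the associated poset of least expressive events, and let $f(\mathcal{E}')\subseteq\mathcal{E}$ be the image of $\mathcal{E}'$ described in the context. The following are equivalent: 1. $(\mathcal{E}',\sqsubseteq)\cong(f(\mathcal{E}'),\leqslant)$ (order isomorphism); 2. $|\mathcal{E}'|=|2^{\sup\mathcal{S}}|$; 3. $(E^\uparrow\cap\sup\mathcal{S})\neq(F^\uparrow\cap\sup\mathcal{S})$ for all distinct events $(E^\uparrow,S),(F^\uparrow,S')\in\mathcal{E}'$.
   Context: State-spaces. $\mathcal{S}$ is a set of pairwise disjoint finite sets (state-spaces) which contains the empty state-space $S_\emptyset=\emptyset$; the other state-spaces are non-empty. It is partially ordered by $\succeq$ ($S'\succeq S$ reads "$S'$ is at least as expressive as $S$"), and $(\mathcal{S},\succeq)$ is a lattice with least element $S_\emptyset$ and greatest (most expressive) element $\sup\mathcal{S}$. Put $\Omega:=\bigcup_{S\in\mathcal{S}}S$. $2^{\sup\mathcal{S}}$ is the full power set of the set $\sup\mathcal{S}$, and $|\cdot|$ denotes cardinality. Projections. For all $S'\succeq S$ with $S\neq S_\emptyset$ there is a surjection $r^{S'}_S:S'\to S$, with $r^S_S=\mathrm{id}_S$ and $r^{S''}_S=r^{S'}_S\circ r^{S''}_{S'}$ whenever $S''\succeq S'\succeq S$. Upper sets. For $S\neq S_\emptyset$ and non-empty $E\subseteq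 S$, let $E^\uparrow:=\bigcup_{S'\in\mathcal{S},\,S'\succeq S}(r^{S'}_S)^{-1}(E)\subseteq\Omega$. By convention $\emptyset^\uparrow=\Omega$, with base-space $S_\emptyset$. Events. The set of events $\mathcal{E}\subseteq 2^\Omega\times\mathcal{S}$ consists of: the pairs $(E^\uparrow,S)$ with $S\in\mathcal{S}\setminus\{S_\emptyset\}$ and $\emptyset\neq E\subseteq S$; the pair $(\Omega,S_\emptyset)$; and the empty event $(\emptyset,\sup\mathcal{S})$. The second component of an event is its base-space. A general event is written $(E^\uparrow,S)$, where for the last two events the first component is $\Omega$, respectively $\emptyset$. Order on events. $(F^\uparrow,S')\leqslant(E^\uparrow,S)$ if and only if $F^\uparrow\subseteq E^\uparrow$ and $S'\succeq S$. Least expressive events. $\mathcal{E}'\subseteq\mathcal{E}$ is the collection of the finest least-expressive descriptions of the events with base-space $\sup\mathcal{S}$, written $$\mathcal{E}':=\{(E^\uparrow,S)\in\mathcal{E}:((E^\uparrow\cap\sup\mathcal{S})^\uparrow,\sup\mathcal{S})\leqslant((E^\uparrow\cap S'')^\uparrow,S'')\leqslant\cdots\leqslant((E^\uparrow\cap S')^\uparrow,S')\leqslant(E^\uparrow,S)\leqslant(F^\uparrow,S)\}\cup\{(\emptyset,\sup\mathcal{S})\},\quad S''\neq S'\neq S.$$ The display is to be read as follows: each $(E^\uparrow,S)\in\mathcal{E}'$ is the description of an event of $\sup\mathcal{S}$, namely $E^\uparrow\cap\sup\mathcal{S}$, within a least expressive state-space $S$, i.e. no event with base-space strictly less expressive than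 $S$ has the same intersection with $\sup\mathcal{S}$; two members with the same intersection with $\sup\mathcal{S}$ are descriptions of the same event within non-ordered state-spaces. Example. For $S_a=\{a,\neg a\}$, $S_b=\{b,\neg b\}$, $S_c=\{c_1,c_2,c_3\}$ with $S_c\succeq S_a$, $S_c\succeq S_b$, where $c_1,c_2\mapsto a$, $c_3\mapsto\neg a$ and $c_1\mapsto b$, $c_2,c_3\mapsto\neg b$, one has $\mathcal{E}'=\{(\{a\}^\uparrow,S_a),(\{\neg a\}^\uparrow,S_a),(\{b\}^\uparrow,S_b),(\{\neg b\}^\uparrow,S_b),(\{c_2\},S_c),(\{c_1,c_3\},S_c),(\emptyset,S_c),(\Omega,\emptyset)\}$. Order on least expressive events. $(F^\uparrow,S')\sqsubseteq(E^\uparrow,S)$ if and only if $(F^\uparrow\cap\sup\mathcal{S})\subseteq(E^\uparrow\cap\sup\mathcal{S})$. The image $f(\mathcal{E}')$. Let $f:2^{\sup\mathcal{S}}\to\mathcal{E}$ be the order embedding of $(2^{\sup\mathcal{S}},\subseteq)$ into $(\mathcal{E},\leqslant)$ sending $T$ to the event $(T,\sup\mathcal{S})$. When the map $g^{-1}:\mathcal{E}'\to 2^{\sup\mathcal{S}}$, $(E^\uparrow,S)\mapsto E^\uparrow\cap\sup\mathcal{S}$, is an order isomorphism, let $g$ be its inverse, and $f(\mathcal{E}')$ denotes the image $(f\circ g)(2^{\sup\mathcal{S}})$, where $f$ is applied to a member $(E^\uparrow,S)$ of $\mathcal{E}'$ through the set $E^\uparrow\cap\sup\mathcal{S}$; accordingly,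 in general, $f(\mathcal{E}')=\{f(E^\uparrow\cap\sup\mathcal{S}):(E^\uparrow,S)\in\mathcal{E}'\}$, ordered by $\leqslant$. An order isomorphism between two sets with relations is a bijection that preserves and reflects the relations.
   Formalization: The formal theorem additionally assumes that there is no infinite strictly descending chain of state-spaces (automatic if the collection of state-spaces is finite); without it an event may have no least expressive description and conditions 1 and 3 can hold while 2 fails. *)

theory Defs
  imports "HOL-Algebra.Lattice" "HOL-Library.Disjoint_Sets" "HOL-Library.Equipollence"
begin

text \<open>
  The state-spaces are the elements of \<^term>\<open>carrier L\<close>; the relation \<open>S' \<succeq> S\<close>
  (\<open>S'\<close> is at least as expressive as \<open>S\<close>) is \<open>S \<sqsubseteq>\<^bsub>L\<^esub> S'\<close>, so that \<open>sup \<S>\<close> is \<open>\<top>\<^bsub>L\<^esub>\<close>.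
  The projection from \<open>S'\<close> to \<open>S\<close> is \<open>r S' S\<close>; its values matter only on \<open>S'\<close>,
  and only for \<open>S \<sqsubseteq>\<^bsub>L\<^esub> S'\<close> with \<open>S \<noteq> {}\<close>.
\<close>

locale state_spaces = bounded_lattice L
  for L :: "'a set gorder" (structure) +
  fixes r :: "'a set \<Rightarrow> 'a set \<Rightarrow> 'a \<Rightarrow> 'a"
  assumes finite_space: "S \<in> carrier L \<Longrightarrow> finite S"
    and disjoint_spaces: "disjoint (carrier L)"
    and bottom_empty: "\<bottom> = {}"
    and proj_surj: "\<lbrakk>S \<in> carrier L; S' \<in> carrier L; S \<sqsubseteq> S'; S \<noteq> {}\<rbrakk> \<Longrightarrow> r S' S ` S' = S"
    and proj_id: "\<lbrakk>S \<in> carrier L; S \<noteq> {}; s \<in> S\<rbrakk> \<Longrightarrow> r S S s = s"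
    and proj_comp: "\<lbrakk>S \<in> carrier L; S' \<in> carrier L; S'' \<in> carrier L;
        S \<sqsubseteq> S'; S' \<sqsubseteq> S''; S \<noteq> {}; s \<in> S''\<rbrakk> \<Longrightarrow> r S'' S s = r S' S (r S'' S' s)"

definition all_states :: "'a set gorder \<Rightarrow> 'a set" where
  "all_states L = \<Union>(carrier L)"

definition upper_set ::
  "'a set gorder \<Rightarrow> ('a set \<Rightarrow> 'a set \<Rightarrow> 'a \<Rightarrow> 'a) \<Rightarrow> 'a set \<Rightarrow> 'a set \<Rightarrow> 'a set" where
  "upper_set L r S E = (\<Union>S' \<in> {S' \<in> carrier L. S \<sqsubseteq>\<^bsub>L\<^esub> S'}. {s \<in> S'. r S' S s \<in> E})"

text \<open>
  The pair \<open>(\<Omega>, {})\<close> is \<open>\<emptyset>\<^sup>\<up>\<close> with base-space \<open>S\<^sub>\<emptyset>\<close>, by the convention \<open>\<emptyset>\<^sup>\<up> = \<Omega>\<close>;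
  it is distinct from the empty event, whose first component is \<open>{}\<close>,
  unless \<open>{}\<close> is the only state-space.
\<close>

definition events ::
  "'a set gorder \<Rightarrow> ('a set \<Rightarrow> 'a set \<Rightarrow> 'a \<Rightarrow> 'a) \<Rightarrow> ('a set \<times> 'a set) set" where
  "events L r =
     {(upper_set L r S E, S) | E S. S \<in> carrier L - {{}} \<and> E \<noteq> {} \<and> E \<subseteq> S}
     \<union> {(all_states L, {})} \<union> {({}, \<top>\<^bsub>L\<^esub>)}"

definition event_le :: "'a set gorder \<Rightarrow> 'a set \<times> 'a set \<Rightarrow> 'a set \<times> 'a set \<Rightarrow> bool" where
  "event_le L = (\<lambda>(F, S') (E, S). F \<subseteq> E \<and> S \<sqsubseteq>\<^bsub>L\<^esub> S')"

text \<open>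
  An event \<open>(E, S)\<close> is least expressive if no event with base-space strictly below \<open>S\<close>
  describes the same subset \<open>E \<inter> \<top>\<^bsub>L\<^esub>\<close> of the most expressive state-space.
\<close>

definition least_expressive_events ::
  "'a set gorder \<Rightarrow> ('a set \<Rightarrow> 'a set \<Rightarrow> 'a \<Rightarrow> 'a) \<Rightarrow> ('a set \<times> 'a set) set" where
  "least_expressive_events L r =
     {(E, S). (E, S) \<in> events L r \<and>
        \<not> (\<exists>(F, S') \<in> events L r. S' \<sqsubset>\<^bsub>L\<^esub> S \<and> F \<inter> \<top>\<^bsub>L\<^esub> = E \<inter> \<top>\<^bsub>L\<^esub>)}
     \<union> {({}, \<top>\<^bsub>L\<^esub>)}"

definition least_expressive_le ::
  "'a set gorder \<Rightarrow> 'a set \<times> 'a set \<Rightarrow> 'a set \<times> 'a set \<Rightarrow> bool" where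
  "least_expressive_le L = (\<lambda>(F, S') (E, S). F \<inter> \<top>\<^bsub>L\<^esub> \<subseteq> E \<inter> \<top>\<^bsub>L\<^esub>)"

text \<open>
  The order embedding of the subsets of \<open>\<top>\<^bsub>L\<^esub>\<close> into the events. The upper set of
  a subset of \<open>\<top>\<^bsub>L\<^esub>\<close> is the subset itself.
\<close>

definition top_event :: "'a set gorder \<Rightarrow> 'a set \<Rightarrow> 'a set \<times> 'a set" where
  "top_event L T = (T, \<top>\<^bsub>L\<^esub>)"

definition least_expressive_image ::
  "'a set gorder \<Rightarrow> ('a set \<Rightarrow> 'a set \<Rightarrow> 'a \<Rightarrow> 'a) \<Rightarrow> ('a set \<times> 'a set) set" where
  "least_expressive_image L r =
     {top_event L (E \<inter> \<top>\<^bsub>L\<^esub>) | E S. (E, S) \<in> least_expressive_events L r}"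

definition order_isomorphic ::
  "'b set \<Rightarrow> ('b \<Rightarrow> 'b \<Rightarrow> bool) \<Rightarrow> 'c set \<Rightarrow> ('c \<Rightarrow> 'c \<Rightarrow> bool) \<Rightarrow> bool" where
  "order_isomorphic A le_A B le_B \<longleftrightarrow>
     (\<exists>h. bij_betw h A B \<and> (\<forall>x\<in>A. \<forall>y\<in>A. le_A x y \<longleftrightarrow> le_B (h x) (h y)))"

end

theory Submission
  imports Defs
begin

text \<open>
  Every \<open>T \<subseteq> \<top>\<close> is described by an event with base-space \<open>\<top>\<close>, hence, descending along the
  well-founded order, by a least expressive event. So \<open>(E, S) \<mapsto> E \<inter> \<top>\<close> maps the least
  expressive events onto the finite power set of \<open>\<top>\<close>, and all three conditions say that this map
  is injective: a surjection onto a finite equipollent set is injective, and the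
  preorder on least expressive events is isomorphic to a partial order only if it is antisymmetric.
\<close>

text \<open>Equipollence makes \<open>A\<close> finite and as large as its image under
  \<open>f\<close>, which forces injectivity. Finiteness is essential: an infinite set can map onto
  an equipollent one without injectivity.\<close>

lemma eqpoll_finite_surj_iff_inj_on:
  assumes "finite B" "f ` A = B"
  shows "A \<approx> B \<longleftrightarrow> inj_on f A"
proof
  assume "A \<approx> B"
  then have "finite A" "card A = card (f ` A)"
    using assms eqpoll_finite_iff[of A B] eqpoll_iff_card[of A B] by auto
  then show "inj_on f A"
    by (simp add: eq_card_imp_inj_on)
next
  assume "inj_on f A"
  then show "A \<approx> B"
    using assms by (auto simp: eqpoll_def bij_betw_def)
qed

text \<open>The given isomorphism \<open>h\<close> may differ from \<open>f\<close>, so the forward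
  direction argues through the order: points with equal \<open>f\<close>-values are below each
  other, hence so are their \<open>h\<close>-images, which antisymmetry identifies.\<close>

lemma order_isomorphic_image_iff_inj_on:
  assumes "\<And>x y. \<lbrakk>x \<in> A; y \<in> A\<rbrakk> \<Longrightarrow> le_A x y \<longleftrightarrow> le_B (f x) (f y)"
    and refl: "\<And>x. x \<in> A \<Longrightarrow> le_B (f x) (f x)"
    and antisym: "\<And>u v. \<lbrakk>u \<in> f ` A; v \<in> f ` A; le_B u v; le_B v u\<rbrakk> \<Longrightarrow> u = v"
  shows "order_isomorphic A le_A (f ` A) le_B \<longleftrightarrow> inj_on f A"
proof
  assume "order_isomorphic A le_A (f ` A) le_B"
  then obtain h where h: "bij_betw h A (f ` A)"
    "\<And>x y. \<lbrakk>x \<in> A; y \<in> A\<rbrakk> \<Longrightarrow> le_A x y \<longleftrightarrow> le_B (h x) (h y)"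
    unfolding order_isomorphic_def by blast
  show "inj_on f A"
  proof (rule inj_onI)
    fix x y
    assume xy: "x \<in> A" "y \<in> A" "f x = f y"
    then have "le_A x y" "le_A y x"
      using assms(1) refl by metis+
    then have "le_B (h x) (h y)" "le_B (h y) (h x)"
      using h(2) xy by blast+
    moreover have "h x \<in> f ` A" "h y \<in> f ` A"
      using h(1) xy bij_betwE by fast+
    ultimately have "h x = h y"
      by (rule antisym[rotated 2])
    then show "x = y"
      using h(1) xy by (auto simp: bij_betw_def inj_on_def)
  qed
next
  assume "inj_on f A"
  then have "bij_betw f A (f ` A)"
    by (simp add: bij_betw_def)
  then show "order_isomorphic A le_A (f ` A) le_B"
    unfolding order_isomorphic_def using assms(1) by blast
qed

context state_spaces
begin

lemma empty_space_in_carrier: "{} \<in> carrier L"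
  using bottom_closed bottom_empty by simp

lemma event_base_in_carrier: "(E, S) \<in> events L r \<Longrightarrow> S \<in> carrier L"
  using empty_space_in_carrier top_closed by (auto simp: events_def)

text \<open>Only \<open>\<top>\<close> lies above \<open>\<top>\<close>, and its projection to
  itself is the identity, so the union has the single term \<open>T\<close>.\<close>

lemma upper_set_top:
  assumes "T \<noteq> {}" "T \<subseteq> \<top>"
  shows "upper_set L r \<top> T = T"
proof -
  have "{S' \<in> carrier L. \<top> \<sqsubseteq> S'} = {\<top>}"
    using top_closed top_higher le_refl le_antisym by blast
  moreover have "r \<top> \<top> s = s" if "s \<in> \<top>" for s
    using that proj_id top_closed by blast
  ultimately show ?thesis
    using assms by (auto simp: upper_set_def)
qed

lemma top_event_in_events:
  assumes "T \<subseteq> \<top>"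
  shows "top_event L T \<in> events L r"
proof (cases "T = {}")
  case True
  then show ?thesis
    by (simp add: top_event_def events_def)
next
  case False
  \<comment> \<open>A non-empty subset forces \<open>\<top>\<close> to be non-empty, as the first
    clause of \<open>events\<close> demands of a base-space.\<close>
  then have "\<top> \<in> carrier L - {{}}"
    using assms top_closed by blast
  then have "(upper_set L r \<top> T, \<top>) \<in> events L r"
    using False assms unfolding events_def by blast
  then show ?thesis
    using False assms by (simp add: upper_set_top top_event_def)
qed

lemma least_expressive_description_exists:
  assumes wf: "wfp_on (carrier L) (\<lambda>S S'. S \<sqsubset> S')" and "T \<subseteq> \<top>"
  obtains E S where "(E, S) \<in> least_expressive_events L r" "E \<inter> \<top> = T"
proof -
  \<comment> \<open>\<open>B\<close> collects base-spaces rather than events: well-foundedness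
    concerns spaces, and least expressiveness only excludes events over strictly smaller
    spaces.\<close>
  define B where "B = {S. \<exists>E. (E, S) \<in> events L r \<and> E \<inter> \<top> = T}"
  have "\<top> \<in> B"
    using top_event_in_events[OF \<open>T \<subseteq> \<top>\<close>] \<open>T \<subseteq> \<top>\<close> by (auto simp: B_def top_event_def)
  moreover have "B \<subseteq> carrier L"
    using event_base_in_carrier by (auto simp: B_def)
  ultimately obtain S where "S \<in> B" and min: "\<And>S'. S' \<sqsubset> S \<Longrightarrow> S' \<notin> B"
    using wf unfolding wfp_on_iff_ex_minimal by (metis empty_iff)
  then obtain E where "(E, S) \<in> events L r" "E \<inter> \<top> = T"
    by (auto simp: B_def)
  moreover from this have "(E, S) \<in> least_expressive_events L r"
    using min unfolding least_expressive_events_def B_def by blast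
  ultimately show thesis
    using that by blast
qed

lemma restriction_image_least_expressive_events:
  assumes "wfp_on (carrier L) (\<lambda>S S'. S \<sqsubset> S')"
  shows "(\<lambda>(E, S). E \<inter> \<top>) ` least_expressive_events L r = Pow \<top>"
proof (rule equalityI)
  show "Pow \<top> \<subseteq> (\<lambda>(E, S). E \<inter> \<top>) ` least_expressive_events L r"
  proof
    fix T
    assume "T \<in> Pow \<top>"
    then obtain E S where "(E, S) \<in> least_expressive_events L r" "E \<inter> \<top> = T"
      using least_expressive_description_exists[OF assms] by blast
    then show "T \<in> (\<lambda>(E, S). E \<inter> \<top>) ` least_expressive_events L r"
      by force
  qed
qed auto

text \<open>The image arises from restriction to \<open>\<top>\<close> followed by the injective map
  \<open>top_event L\<close>. Between events over \<open>\<top>\<close>, \<open>event_le\<close>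
  reduces to inclusion, so it is reflexive and antisymmetric there and the general criterion
  applies.\<close>

lemma order_isomorphic_least_expressive_image_iff:
  "order_isomorphic (least_expressive_events L r) (least_expressive_le L)
      (least_expressive_image L r) (event_le L)
    \<longleftrightarrow> inj_on (\<lambda>(E, S). E \<inter> \<top>) (least_expressive_events L r)"
proof -
  let ?f = "\<lambda>(E, S). top_event L (E \<inter> \<top>)"
  have image: "least_expressive_image L r = ?f ` least_expressive_events L r"
    by (force simp: least_expressive_image_def)
  have inj: "inj_on ?f A \<longleftrightarrow> inj_on (\<lambda>(E, S). E \<inter> \<top>) A" for A :: "('a set \<times> 'a set) set"
    by (auto simp: inj_on_def top_event_def)
  show ?thesis
    unfolding image inj[symmetric]
    by (rule order_isomorphic_image_iff_inj_on)
      (auto simp: top_event_def event_le_def least_expressive_le_def)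
qed

end

text \<open>There may be infinitely many spaces, and an infinite descending chain joined by
  bijective projections could leave a subset of \<open>\<top>\<close> without a least expressive
  description; \<open>no_infinite_descent\<close> excludes this and holds automatically for finite
  \<open>carrier L\<close>.\<close>

theorem theorem6:
  fixes L :: "'a set gorder" and r :: "'a set \<Rightarrow> 'a set \<Rightarrow> 'a \<Rightarrow> 'a"
  assumes spaces: "state_spaces L r"
    and no_infinite_descent: "wfp_on (carrier L) (\<lambda>S S'. S \<sqsubset>\<^bsub>L\<^esub> S')"
  shows
    "(order_isomorphic (least_expressive_events L r) (least_expressive_le L)
        (least_expressive_image L r) (event_le L)
      \<longleftrightarrow> least_expressive_events L r \<approx> Pow \<top>\<^bsub>L\<^esub>)
     \<and> (least_expressive_events L r \<approx> Pow \<top>\<^bsub>L\<^esub>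
      \<longleftrightarrow> (\<forall>(E, S) \<in> least_expressive_events L r. \<forall>(F, S') \<in> least_expressive_events L r.
            (E, S) \<noteq> (F, S') \<longrightarrow> E \<inter> \<top>\<^bsub>L\<^esub> \<noteq> F \<inter> \<top>\<^bsub>L\<^esub>))"
proof -
  interpret state_spaces L r
    by (rule spaces)
  have "finite (Pow \<top>\<^bsub>L\<^esub>)"
    using finite_space top_closed by simp
  then have "least_expressive_events L r \<approx> Pow \<top>\<^bsub>L\<^esub>
      \<longleftrightarrow> inj_on (\<lambda>(E, S). E \<inter> \<top>\<^bsub>L\<^esub>) (least_expressive_events L r)"
    using restriction_image_least_expressive_events[OF no_infinite_descent]
    by (rule eqpoll_finite_surj_iff_inj_on)
  moreover have "inj_on (\<lambda>(E, S). E \<inter> \<top>\<^bsub>L\<^esub>) (least_expressive_events L r)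
      \<longleftrightarrow> (\<forall>(E, S) \<in> least_expressive_events L r. \<forall>(F, S') \<in> least_expressive_events L r.
            (E, S) \<noteq> (F, S') \<longrightarrow> E \<inter> \<top>\<^bsub>L\<^esub> \<noteq> F \<inter> \<top>\<^bsub>L\<^esub>)"
    unfolding inj_on_def by fast
  ultimately show ?thesis
    by (simp only: order_isomorphic_least_expressive_image_iff)
qed

end
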